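(* Let $k$ be a field with $\operatorname{char}(k)\neq 2,3$, let $\pi:\mathbb{A}\to\mathbb{A}$ be the Pappus-Steiner map over $k$, and let $$B=\{[x,y]\in\mathbb{A}: x^2=4y\},\qquad H=\{[x,y]\in\mathbb{A}: x=y+1\}.$$ Then $\pi(H)\subseteq B$ and $\pi(B)\subseteq H$.
   Context: The Pappus-Steiner map is the partially defined map $\pi$ on $k^2$ given by $\pi([x,y])=\left[\frac{2y(y-x+2)}{(x-y)^2},\frac{y^2}{(x-y)^2}\right]$, defined for $x\neq y$. Let $W_1=\{[x,y]\in k^2: x=y\}$ and inductively $W_n=\{[x,y]\in k^2\setminus\bigcup_{i=1}^{n-1}W_i:\ \pi([x,y])\in W_{n-1}\}$ for $n\geq 2$. Put $\mathbb{A}=k^2\setminus\bigcup_{i\ge 1}W_i$; this is the set of points at which all iterates of $\pi$ are defined, and $\pi$ restricts to a map $\mathbb{A}\to\mathbb{A}$. *)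

theory Defs
  imports Complex_Main
begin

(* The partially defined map pi is represented by a total function. Where x = y, division
   by zero in HOL gives the junk value (0, 0); W, dom_A, B and H below never depend on it, since
   the map is only applied to points outside W 1. *)
definition pappus_steiner :: "'k::field \<times> 'k \<Rightarrow> 'k \<times> 'k" where
  "pappus_steiner = (\<lambda>(x, y). (2 * y * (y - x + 2) / (x - y)^2, y^2 / (x - y)^2))"

(* The sequence is indexed from 1; W 0 is a dummy value. *)
fun W :: "nat \<Rightarrow> ('k::field \<times> 'k) set" where
  "W 0 = {}"
| "W (Suc 0) = {(x, y). x = y}"
| "W (Suc (Suc n)) =
     {p \<in> UNIV - (\<Union>i\<in>{1..Suc n}. W i). pappus_steiner p \<in> W (Suc n)}"

definition dom_A :: "('k::field \<times> 'k) set" where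
  "dom_A = UNIV - (\<Union>i\<in>{1..}. W i)"

definition B :: "('k::field \<times> 'k) set" where
  "B = {(x, y). (x, y) \<in> dom_A \<and> x^2 = 4 * y}"

definition H :: "('k::field \<times> 'k) set" where
  "H = {(x, y). (x, y) \<in> dom_A \<and> x = y + 1}"

end

theory Submission
  imports Defs
begin

text \<open>Both inclusions are direct substitutions into the formula of the map, once
  \<open>pappus_steiner_dom_A\<close> ensures that images stay in \<open>dom_A\<close>. The line x =
  y + 1 is sent into the parabola by y \<mapsto> (2y, y^2); on the parabola the two image
  coordinates differ by 1.\<close>

lemma dom_A_iff: "p \<in> dom_A \<longleftrightarrow> (\<forall>n. p \<notin> W (Suc n))"
  by (auto simp: dom_A_def Suc_le_eq gr0_conv_Suc)

lemma dom_A_fst_neq_snd: "(x, y) \<in> dom_A \<Longrightarrow> x \<noteq> y"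
  using dom_A_iff[of "(x, y)"] W.simps(2) by blast

text \<open>If the image lay in \<open>W (Suc n)\<close>, then p would lie in
  \<open>W (Suc (Suc n))\<close> or already in an earlier \<open>W i\<close>; both are
  excluded.\<close>

lemma pappus_steiner_dom_A:
  assumes "p \<in> dom_A"
  shows "pappus_steiner p \<in> dom_A"
  unfolding dom_A_iff
proof
  fix n
  have "p \<notin> (\<Union>i\<in>{1..Suc n}. W i)"
    using assms by (auto simp: dom_A_def)
  moreover have "p \<notin> W (Suc (Suc n))"
    using assms dom_A_iff by blast
  ultimately show "pappus_steiner p \<notin> W (Suc n)"
    by simp
qed

text \<open>Here x - y = 1, so the denominators and the factor y - x + 2 all become 1.\<close>

lemma pappus_steiner_H: "p \<in> H \<Longrightarrow> pappus_steiner p \<in> B"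
  using pappus_steiner_dom_A[of p]
  by (auto simp: H_def B_def pappus_steiner_def power2_eq_square)

lemma pappus_steiner_B:
  assumes "p \<in> B"
  shows "pappus_steiner p \<in> H"
proof -
  obtain x y where p: "p = (x, y)" "(x, y) \<in> dom_A" "x^2 = 4 * y"
    using assms by (auto simp: B_def)
  have "(x - y)^2 \<noteq> 0"
    using dom_A_fst_neq_snd[OF p(2)] by simp
  \<comment> \<open>Expand the left side and replace the term 4y by x^2; dividing by (x - y)^2,
    nonzero off the diagonal, then yields the summand 1.\<close>
  moreover have "2 * y * (y - x + 2) = y^2 + (x - y)^2"
    using p(3) by algebra
  ultimately have "2 * y * (y - x + 2) / (x - y)^2 = y^2 / (x - y)^2 + 1"
    by (simp add: add_divide_distrib)
  then show ?thesis
    using pappus_steiner_dom_A[OF p(2)] by (simp add: H_def p(1) pappus_steiner_def)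
qed

theorem proposition3p1:
  assumes "CHAR('k::field) \<noteq> 2" and "CHAR('k) \<noteq> 3"
  shows "pappus_steiner ` (H :: ('k \<times> 'k) set) \<subseteq> B \<and>
         pappus_steiner ` (B :: ('k \<times> 'k) set) \<subseteq> H"
  using pappus_steiner_H pappus_steiner_B by blast

end
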